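(* 1. Let $\mathrm{SWAP}=|0000\rangle+|0101\rangle+|1010\rangle+|1111\rangle$ (the 4-arity swap gate). There do not exist invertible matrices $A,B,C,D\in\mathbb{C}^{2\times2}$ such that the SWAP gate is Pfaffian under the change of basis $A\otimes B\otimes C\otimes D$. 2. Let $\mathrm{SWAP}=\langle0000|+\langle0101|+\langle1010|+\langle1111|$ (the 4-arity swap cogate). There do not exist invertible matrices $A,B,C,D\in\mathbb{C}^{2\times2}$ such that the SWAP cogate is Pfaffian under the change of basis $A^{-1}\otimes B^{-1}\otimes C^{-1}\otimes D^{-1}$.
   Context: Let $V=\mathbb{C}^2$ with basis $|0\rangle,|1\rangle$ and dual basis $\langle0|,\langle1|$. An $n$-arity gate is an element of $V^{\otimes n}$, and an $n$-arity cogate is an element of $(V^* )^{\otimes n}$. For $I\subseteq[n]=\{1,\dots,n\}$, $|I\rangle$ and $\langle I|$ denote the basis ket and bra whose bitstring is the indicator of $I$, and $I^C=[n]\setminus I$. Rows and columns of $2\times2$ matrices are indexed by $0,1$. A matrix $M$ acts on kets by $M|j\rangle=M_{0j}|0\rangle+M_{1j}|1\rangle$ and on bras by $M\langle j|=M_{j0}\langle0|+M_{j1}\langle1|$ (row-vector multiplication). For an $n\times n$ complex skew-symmetric matrix $\Xi$ put $\mathrm{sPf}(\Xi)=\sum_{I\subseteq[n]}\mathrm{Pf}(\Xi|_I)|I\rangle$ and $\mathrm{sPf}^*(\Xi)=\sum_{J\subseteq[n]}\mathrm{Pf}(\Xi|_{J^C})\langle J|$, where $\Xi|_I$ is the submatrix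 with rows and columns in $I$, and the Pfaffian $\mathrm{Pf}$ is $1$ for the empty matrix and $0$ for odd size. A gate $G$ of arity $n$ is Pfaffian under $A_1\otimes\cdots\otimes A_n$ if $(A_1\otimes\cdots\otimes A_n)G=\alpha\,\mathrm{sPf}(\Xi)$ for some $\alpha\in\mathbb{C}$ and skew-symmetric $\Xi\in\mathbb{C}^{n\times n}$. A cogate $C$ of arity $n$ is Pfaffian under $A_1^{-1}\otimes\cdots\otimes A_n^{-1}$ if $(A_1^{-1}\otimes\cdots\otimes A_n^{-1})C=\beta\,\mathrm{sPf}^*(\Theta)$ for some $\beta\in\mathbb{C}$ and skew-symmetric $\Theta\in\mathbb{C}^{n\times n}$. The order of the tensor factors is the order of the wires $1,2,3,4$ around the vertex. *)

theory Defs
  imports "HOL-Analysis.Analysis"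
begin

text \<open>
  The wires are the elements of a finite linearly ordered type \<open>'n\<close>; for arity 4 this is the
  numeral type \<open>4\<close>, whose elements are \<open>0 < 1 < 2 < 3\<close> (so wire \<open>k\<close> of the literature is \<open>k - 1\<close>
  here).  The basis of the \<open>n\<close>-fold tensor power of \<open>\<complex>\<^sup>2\<close> is indexed by sets of wires, a set
  standing for the bitstring that is its indicator.  Gates are coordinate vectors with respect to
  the basis kets, cogates with respect to the dual basis of bras.
\<close>

type_synonym 'n gate = "complex ^ ('n set)"
type_synonym 'n cogate = "complex ^ ('n set)"

definition ket :: "'n::finite set \<Rightarrow> 'n gate" where
  "ket I = axis I 1"

definition bra :: "'n::finite set \<Rightarrow> 'n cogate" where
  "bra I = axis I 1"

text \<open>
  The tensor (Kronecker) product of a family of 2-by-2 matrices.  It acts on gates from the left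
  by \<open>*v\<close> and on cogates by row-vector multiplication \<open>v*\<close>.  Rows and columns of the factors are
  indexed by \<open>0, 1 :: 2\<close>.
\<close>

definition tensor_mat :: "('n::finite \<Rightarrow> complex^2^2) \<Rightarrow> complex ^ ('n set) ^ ('n set)" where
  "tensor_mat A = (\<chi> I J. \<Prod>k\<in>UNIV. A k $ of_bool (k \<in> I) $ of_bool (k \<in> J))"

definition skew_symmetric :: "complex^'n^'n \<Rightarrow> bool" where
  "skew_symmetric M \<longleftrightarrow> transpose M = - M"

text \<open>The Pfaffian of the \<open>n\<close>-by-\<open>n\<close> matrix with entries \<open>M i j\<close>, \<open>i, j < n\<close>.\<close>

definition pfaffian :: "nat \<Rightarrow> (nat \<Rightarrow> nat \<Rightarrow> complex) \<Rightarrow> complex" where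
  "pfaffian n M =
    (if odd n then 0
     else (\<Sum>p | p permutes {..<n}.
             of_int (sign p) * (\<Prod>i<n div 2. M (p (2 * i)) (p (2 * i + 1))))
          / (2 ^ (n div 2) * fact (n div 2)))"

text \<open>Rows and columns in \<open>I\<close>, renumbered increasingly as \<open>0, \<dots>, card I - 1\<close>.\<close>

definition principal_submatrix ::
    "complex^('n::{finite,linorder})^('n::{finite,linorder}) \<Rightarrow> 'n set \<Rightarrow> nat \<Rightarrow> nat \<Rightarrow> complex" where
  "principal_submatrix M I i j = M $ (sorted_list_of_set I ! i) $ (sorted_list_of_set I ! j)"

definition sub_pfaffian :: "complex^('n::{finite,linorder})^('n::{finite,linorder}) \<Rightarrow> 'n set \<Rightarrow> complex" where
  "sub_pfaffian M I = pfaffian (card I) (principal_submatrix M I)"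

definition sPf :: "complex^('n::{finite,linorder})^('n::{finite,linorder}) \<Rightarrow> 'n gate" where
  "sPf X = (\<Sum>I\<in>UNIV. sub_pfaffian X I *s ket I)"

definition sPf_dual :: "complex^('n::{finite,linorder})^('n::{finite,linorder}) \<Rightarrow> 'n cogate" where
  "sPf_dual X = (\<Sum>J\<in>UNIV. sub_pfaffian X (- J) *s bra J)"

definition pfaffian_gate_under ::
    "('n::{finite,linorder}) gate \<Rightarrow> ('n \<Rightarrow> complex^2^2) \<Rightarrow> bool" where
  "pfaffian_gate_under G A \<longleftrightarrow>
    (\<exists>\<alpha> \<Xi>. skew_symmetric \<Xi> \<and> tensor_mat A *v G = \<alpha> *s sPf \<Xi>)"

text \<open>The family \<open>B\<close> is the one that acts on the cogate, i.e. the family of the inverses.\<close>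

definition pfaffian_cogate_under ::
    "('n::{finite,linorder}) cogate \<Rightarrow> ('n \<Rightarrow> complex^2^2) \<Rightarrow> bool" where
  "pfaffian_cogate_under C B \<longleftrightarrow>
    (\<exists>\<beta> \<Theta>. skew_symmetric \<Theta> \<and> C v* tensor_mat B = \<beta> *s sPf_dual \<Theta>)"

definition on_wires :: "'a \<Rightarrow> 'a \<Rightarrow> 'a \<Rightarrow> 'a \<Rightarrow> 4 \<Rightarrow> 'a" where
  "on_wires a b c d k = (if k = 0 then a else if k = 1 then b else if k = 2 then c else d)"

text \<open>The bitstrings 0000, 0101, 1010, 1111 are the indicators of the sets below.\<close>

definition swap_gate :: "4 gate" where
  "swap_gate = ket {} + ket {1, 3} + ket {0, 2} + ket {0, 1, 2, 3}"

definition swap_cogate :: "4 cogate" where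
  "swap_cogate = bra {} + bra {1, 3} + bra {0, 2} + bra {0, 1, 2, 3}"

end

theory Submission
  imports Defs
begin

text \<open>
  The swap gate pairs wire 0 with wire 2 and wire 1 with wire 3.  After a change of basis
  \<open>A \<otimes> B \<otimes> C \<otimes> D\<close> it therefore still factors across these two pairs: its coordinates are the
  products \<open>M\<^sub>i\<^sub>k N\<^sub>j\<^sub>l\<close> with \<open>M = A C\<^sup>T\<close> and \<open>N = B D\<^sup>T\<close>, which are invertible when the changes of
  basis are (lemma \<open>tensor_mat_swap_gate\<close>).

  Multiples of \<open>sPf\<close> satisfy two kinds of equations.  The coordinates at sets of odd size vanish,
  and since \<open>Pf = X\<^sub>0\<^sub>1 X\<^sub>2\<^sub>3 - X\<^sub>0\<^sub>2 X\<^sub>1\<^sub>3 + X\<^sub>0\<^sub>3 X\<^sub>1\<^sub>2\<close> for a 4-by-4 skew-symmetric matrix, the coordinates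
  at sets of even size satisfy a quadratic relation.  Both are unchanged if every set is replaced
  by its complement, so multiples of \<open>sPf_dual\<close> satisfy them as well.

  The two requirements contradict each other.  For \<open>M\<^sub>i\<^sub>k N\<^sub>j\<^sub>l\<close>, the parity condition forces \<open>M\<close>
  and \<open>N\<close> to be both diagonal or both antidiagonal.  The two coordinates at \<open>{0, 2}\<close> and
  \<open>{1, 3}\<close>, which belong to the crossing pairing and so enter with the minus sign, multiply to
  the same number as those at \<open>{}\<close> and \<open>{0, 1, 2, 3}\<close>.  The quadratic relation thus becomes
  \<open>2 M\<^sub>0\<^sub>0 M\<^sub>1\<^sub>1 N\<^sub>0\<^sub>0 N\<^sub>1\<^sub>1 = 2 M\<^sub>0\<^sub>1 M\<^sub>1\<^sub>0 N\<^sub>0\<^sub>1 N\<^sub>1\<^sub>0\<close>.  One side is zero and the other is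
  twice the product of the two determinants, which is not.

  For the cogate, row-vector multiplication by a tensor product is multiplication by the tensor
  product of the transposes, so it is covered by the same argument.
\<close>

section \<open>Pfaffians of small matrices\<close>

text \<open>
  A permutation of \<open>insert a S\<close> is a permutation of \<open>S\<close>, possibly followed by the transposition of
  \<open>a\<close> with an element of \<open>S\<close>, which flips the sign.  Rewriting with this equation eliminates the
  signs from an alternating sum over the permutations of an explicit finite set.
\<close>

lemma signed_sum_permutes_insert:
  fixes h :: "('a \<Rightarrow> 'a) \<Rightarrow> 'b::comm_ring_1"
  assumes S: "finite S" "a \<notin> S"
  shows "(\<Sum>p | p permutes insert a S. of_int (sign p) * h p) =
     (\<Sum>q | q permutes S. of_int (sign q) * h q)
     - (\<Sum>b\<in>S. \<Sum>q | q permutes S. of_int (sign q) * h (Transposition.transpose a b \<circ> q))"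
proof -
  have "sign (Transposition.transpose a b \<circ> q) = - sign q" if "b \<in> S" "q permutes S" for b q
  proof -
    have "permutation q"
      using that S permutation_permutes by blast
    then show ?thesis
      using that S by (auto simp: sign_compose permutation_swap_id sign_swap_id)
  qed
  then show ?thesis
    using S by (simp add: sum_over_permutations_insert sum_negf)
qed

lemma pfaffian_0: "pfaffian 0 M = 1"
  by (simp add: pfaffian_def)

lemma pfaffian_2: "pfaffian 2 M = (M 0 1 - M 1 0) / 2"
proof -
  have "{..<2::nat} = {0, 1}"
    by auto
  then show ?thesis
    by (simp add: pfaffian_def signed_sum_permutes_insert)
qed

lemma pfaffian_4:
  assumes skew: "\<And>i j. M i j = - M j i"
  shows "pfaffian 4 M = M 0 1 * M 2 3 - M 0 2 * M 1 3 + M 0 3 * M 1 2"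
proof -
  have below_diagonal: "M 1 0 = - M 0 1" "M 2 0 = - M 0 2" "M 3 0 = - M 0 3"
      "M 2 1 = - M 1 2" "M 3 1 = - M 1 3" "M 3 2 = - M 2 3"
    by (rule skew)+
  have ranges: "{..<4::nat} = {0, 1, 2, 3}" "{..<2::nat} = {0, 1}"
    by auto
  show ?thesis
    unfolding pfaffian_def
    by (simp add: signed_sum_permutes_insert ranges del: One_nat_def)
      (simp add: fact_numeral below_diagonal[simplified] Transposition.transpose_def)
qed

lemma transpose_nth: "transpose X $ i $ j = X $ j $ i"
  by (simp add: transpose_def)

lemma skew_symmetric_nth:
  assumes "skew_symmetric X"
  shows "X $ i $ j = - X $ j $ i"
proof -
  have "transpose X $ j $ i = (- X) $ j $ i"
    using assms by (simp add: skew_symmetric_def)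
  then show ?thesis
    by (simp add: transpose_nth)
qed

lemma sub_pfaffian_empty: "sub_pfaffian X {} = 1"
  by (simp add: sub_pfaffian_def pfaffian_0)

lemma sub_pfaffian_odd: "odd (card I) \<Longrightarrow> sub_pfaffian X I = 0"
  by (simp add: sub_pfaffian_def pfaffian_def)

lemma sub_pfaffian_pair:
  assumes "skew_symmetric X" "i < j"
  shows "sub_pfaffian X {i, j} = X $ i $ j"
proof -
  have "sorted_list_of_set {i, j} = [i, j]" "card {i, j} = 2"
    using assms by auto
  then show ?thesis
    using skew_symmetric_nth[OF assms(1), of j i]
    by (simp add: sub_pfaffian_def pfaffian_2 principal_submatrix_def)
qed

lemma sub_pfaffian_quadruple:
  assumes "skew_symmetric X" "i < j" "j < k" "k < l"
  shows "sub_pfaffian X {i, j, k, l} =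
    X $ i $ j * X $ k $ l - X $ i $ k * X $ j $ l + X $ i $ l * X $ j $ k"
proof -
  have less: "i < k" "i < l" "j < l"
    using assms by auto
  have "sorted [i, j, k, l]" "distinct [i, j, k, l]"
    using assms less by auto
  then have elems: "sorted_list_of_set {i, j, k, l} = [i, j, k, l]"
    using sorted_list_of_set.idem_if_sorted_distinct[of "[i, j, k, l]"]
    by (simp only: list.set)
  have card: "card {i, j, k, l} = 4"
    using distinct_card[OF \<open>distinct [i, j, k, l]\<close>] by simp
  have "principal_submatrix X I a b = - principal_submatrix X I b a" for I a b
    unfolding principal_submatrix_def by (rule skew_symmetric_nth[OF assms(1)])
  note pfaffian_4[of "principal_submatrix X {i, j, k, l}", OF this]
  then show ?thesis
    by (simp only: sub_pfaffian_def card) (simp add: principal_submatrix_def elems)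
qed

section \<open>Equations for Pfaffian gates and cogates of arity four\<close>

text \<open>
  These are the matchgate identities in arity four.  They are homogeneous in \<open>T\<close>, hence insensitive
  to the scalar in front of a Pfaffian gate, even when it is zero.
\<close>

definition matchgate_identities :: "4 gate \<Rightarrow> bool" where
  "matchgate_identities T \<longleftrightarrow>
    (\<forall>I. odd (card I) \<longrightarrow> T $ I = 0) \<and>
    T $ {} * T $ {0, 1, 2, 3} =
      T $ {0, 1} * T $ {2, 3} - T $ {0, 2} * T $ {1, 3} + T $ {0, 3} * T $ {1, 2}"

lemma wire_less: "(0::4) < 1" "(1::4) < 2" "(2::4) < 3" "(0::4) < 2" "(0::4) < 3" "(1::4) < 3"
  by (simp_all add: less_bit0_def bit0.Rep_0 bit0.Rep_1 bit0.Rep_numeral)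

lemma UNIV_wires: "(UNIV :: 4 set) = {0, 1, 2, 3}"
proof -
  have "(4::4) = 0"
    by simp
  then show ?thesis
    unfolding UNIV_4 by (simp only:) blast
qed

lemma sPf_nth: "sPf X $ I = sub_pfaffian X I"
  by (simp add: sPf_def ket_def axis_def if_distrib[of "(*) _"] cong: if_cong)

lemma sPf_dual_nth: "sPf_dual X $ J = sub_pfaffian X (- J)"
  by (simp add: sPf_dual_def bra_def axis_def if_distrib[of "(*) _"] cong: if_cong)

lemma matchgate_identities_sPf:
  assumes "skew_symmetric X"
  shows "matchgate_identities (c *s sPf X)"
  using assms
  by (simp add: matchgate_identities_def sPf_nth sub_pfaffian_odd sub_pfaffian_empty
      sub_pfaffian_pair sub_pfaffian_quadruple wire_less algebra_simps)

text \<open>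
  Complementation preserves the parity of a set of four wires and exchanges the two factors in each
  term of the quadratic relation.
\<close>

lemma matchgate_identities_sPf_dual:
  assumes "skew_symmetric X"
  shows "matchgate_identities (c *s sPf_dual X)"
proof -
  have odd_Compl: "odd (card (- I))" if "odd (card I)" for I :: "4 set"
  proof -
    have "card I \<le> 4"
      using card_mono[of "UNIV :: 4 set" I] by simp
    then show ?thesis
      using that by (simp add: Compl_eq_Diff_UNIV card_Diff_subset)
  qed
  have complements: "- {} = {0, 1, 2, 3 :: 4}" "- {0, 1, 2, 3 :: 4} = {}"
      "- {0, 1} = {2, 3 :: 4}" "- {2, 3} = {0, 1 :: 4}" "- {0, 2} = {1, 3 :: 4}"
      "- {1, 3} = {0, 2 :: 4}" "- {0, 3} = {1, 2 :: 4}" "- {1, 2} = {0, 3 :: 4}"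
    unfolding Compl_eq_Diff_UNIV UNIV_wires by (simp_all add: insert_Diff_if)
  show ?thesis
    using assms odd_Compl
    unfolding matchgate_identities_def vector_smult_component sPf_dual_nth complements
    by (simp add: sub_pfaffian_odd sub_pfaffian_empty sub_pfaffian_pair sub_pfaffian_quadruple
        wire_less algebra_simps)
qed

section \<open>Transformed swap gates violate the equations\<close>

lemma UNIV_zero_one: "(UNIV :: 2 set) = {0, 1}"
proof -
  have "(2::2) = 0"
    by simp
  then show ?thesis
    unfolding UNIV_2 by (metis insert_commute)
qed

lemma det_2_zero_one:
  fixes M :: "'a::comm_ring_1^2^2"
  shows "det M = M $ 0 $ 0 * M $ 1 $ 1 - M $ 0 $ 1 * M $ 1 $ 0"
proof -
  have "(2::2) = 0"
    by simp
  then show ?thesis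
    unfolding det_2 by (metis mult.commute)
qed

lemma tensor_mat_on_wires_nth:
  "tensor_mat (on_wires A B C D) $ I $ J =
    A $ of_bool (0 \<in> I) $ of_bool (0 \<in> J) * B $ of_bool (1 \<in> I) $ of_bool (1 \<in> J) *
    C $ of_bool (2 \<in> I) $ of_bool (2 \<in> J) * D $ of_bool (3 \<in> I) $ of_bool (3 \<in> J)"
  by (simp only: tensor_mat_def vec_lambda_beta UNIV_wires) (simp add: on_wires_def mult.assoc)

text \<open>
  In terms of tensor diagrams: the swap gate is two crossing wires, so composing it with the changes
  of basis composes \<open>A\<close> with \<open>C\<close> along one of them and \<open>B\<close> with \<open>D\<close> along the other.
\<close>

lemma tensor_mat_swap_gate:
  "(tensor_mat (on_wires A B C D) *v swap_gate) $ J =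
    (A ** transpose C) $ of_bool (0 \<in> J) $ of_bool (2 \<in> J) *
    (B ** transpose D) $ of_bool (1 \<in> J) $ of_bool (3 \<in> J)"
proof -
  have mult_transpose: "(X ** transpose Y) $ i $ j = X $ i $ 0 * Y $ j $ 0 + X $ i $ 1 * Y $ j $ 1"
    for X Y :: "complex^2^2" and i j
    by (simp add: matrix_matrix_mult_def transpose_def UNIV_zero_one)
  have mult_axis: "(X *v axis I 1) $ K = X $ K $ I" for X :: "complex ^ (4 set) ^ (4 set)" and I K
    by (simp add: matrix_vector_mult_def axis_def if_distrib[of "(*) _"] cong: if_cong)
  show ?thesis
    unfolding swap_gate_def ket_def matrix_vector_right_distrib vector_add_component mult_axis
      tensor_mat_on_wires_nth mult_transpose
    \<comment> \<open>Left unsplit, the bits of \<open>J\<close> stay symbolic and one distributivity computation covers all 16 sets.\<close>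
    by (simp add: distrib_left distrib_right split del: split_of_bool)
qed

text \<open>
  With \<open>M = A C\<^sup>T\<close> and \<open>N = B D\<^sup>T\<close>: if \<open>M\<close> is diagonal, the parity condition makes \<open>N\<close> diagonal, and the quadratic relation forces
  the product of all diagonal entries to vanish; the antidiagonal case is the same with the other
  side of the relation.
\<close>

lemma not_matchgate_identities_swap:
  assumes "invertible A" "invertible B" "invertible C" "invertible D"
  shows "\<not> matchgate_identities (tensor_mat (on_wires A B C D) *v swap_gate)"
proof
  define M where "M = A ** transpose C"
  define N where "N = B ** transpose D"
  assume "matchgate_identities (tensor_mat (on_wires A B C D) *v swap_gate)"
  then have odd_zero:
      "odd (card J) \<Longrightarrow>
        M $ of_bool (0 \<in> J) $ of_bool (2 \<in> J) * N $ of_bool (1 \<in> J) $ of_bool (3 \<in> J) = 0"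
    and quadratic: "M$0$0 * M$1$1 * (N$0$0 * N$1$1) = M$0$1 * M$1$0 * (N$0$1 * N$1$0)"
    for J :: "4 set"
    by (simp_all add: matchgate_identities_def tensor_mat_swap_gate ac_simps
        flip: M_def N_def split del: split_of_bool)
  \<comment> \<open>The odd sets pair every diagonal entry of one matrix with every antidiagonal entry of the other.\<close>
  have diag_antidiag: "M$0$0 * N$0$1 = 0" "M$0$0 * N$1$0 = 0" "M$1$1 * N$0$1 = 0" "M$1$1 * N$1$0 = 0"
    using odd_zero[of "{3}"] odd_zero[of "{1}"] odd_zero[of "{0,2,3}"] odd_zero[of "{0,1,2}"] by simp_all
  have antidiag_diag: "M$0$1 * N$0$0 = 0" "M$0$1 * N$1$1 = 0" "M$1$0 * N$0$0 = 0" "M$1$0 * N$1$1 = 0"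
    using odd_zero[of "{2}"] odd_zero[of "{1,2,3}"] odd_zero[of "{0}"] odd_zero[of "{0,1,3}"] by simp_all
  have "M$0$0 * M$1$1 - M$0$1 * M$1$0 \<noteq> 0" "N$0$0 * N$1$1 - N$0$1 * N$1$0 \<noteq> 0"
    using assms
    by (simp_all add: M_def N_def invertible_det_nz det_mul det_transpose flip: det_2_zero_one)
  with diag_antidiag antidiag_diag quadratic show False
    by auto
qed

text \<open>The bra basis and the ket basis have the same coordinates, hence so do the two swaps.\<close>

lemma swap_cogate_vector_mult_tensor_mat:
  "swap_cogate v* tensor_mat (on_wires A B C D) =
    tensor_mat (on_wires (transpose A) (transpose B)
      (transpose C) (transpose D)) *v swap_gate"
proof -
  have "transpose (tensor_mat (on_wires A B C D)) =
      tensor_mat (on_wires (transpose A)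
        (transpose B) (transpose C)
        (transpose D))"
    by (simp only: vec_eq_iff transpose_nth tensor_mat_on_wires_nth) simp
  moreover have "swap_cogate = swap_gate"
    by (simp add: swap_cogate_def swap_gate_def ket_def bra_def)
  ultimately show ?thesis
    by (metis transpose_matrix_vector transpose_transpose)
qed

lemma invertible_matrix_inv:
  assumes "invertible A"
  shows "invertible (matrix_inv A)"
proof -
  have "A ** matrix_inv A = mat 1 \<and> matrix_inv A ** A = mat 1"
    using assms unfolding invertible_def matrix_inv_def by (rule someI_ex)
  then show ?thesis
    unfolding invertible_def by blast
qed

theorem theorem6:
  shows "(\<nexists>A B C D :: complex^2^2.
            invertible A \<and> invertible B \<and> invertible C \<and> invertible D \<and>
            pfaffian_gate_under swap_gate (on_wires A B C D))
       \<and> (\<nexists>A B C D :: complex^2^2.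
            invertible A \<and> invertible B \<and> invertible C \<and> invertible D \<and>
            pfaffian_cogate_under swap_cogate
              (on_wires (matrix_inv A) (matrix_inv B) (matrix_inv C) (matrix_inv D)))"
proof (intro conjI notI; elim exE conjE)
  fix A B C D :: "complex^2^2"
  assume "invertible A" "invertible B" "invertible C" "invertible D"
    and "pfaffian_gate_under swap_gate (on_wires A B C D)"
  then show False
    using not_matchgate_identities_swap matchgate_identities_sPf
    unfolding pfaffian_gate_under_def by metis
next
  fix A B C D :: "complex^2^2"
  assume inv: "invertible A" "invertible B" "invertible C" "invertible D"
    and pf: "pfaffian_cogate_under swap_cogate
      (on_wires (matrix_inv A) (matrix_inv B) (matrix_inv C) (matrix_inv D))"
  have "invertible (transpose (matrix_inv X))"
    if "invertible X" for X :: "complex^2^2"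
    using invertible_matrix_inv[OF that] by (simp add: invertible_det_nz det_transpose)
  from not_matchgate_identities_swap[OF this[OF inv(1)] this[OF inv(2)] this[OF inv(3)] this[OF inv(4)]]
  show False
    using pf matchgate_identities_sPf_dual
    unfolding pfaffian_cogate_under_def swap_cogate_vector_mult_tensor_mat by metis
qed

end
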